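(* Let $d\ge0$. Consider the Schubert matroids $\mathrm{SM}(A)$ for all subsets $A\subseteq[d]$ such that $A\ne\{1,2,\dots,k\}$ for every $k=0,1,\dots,d-1$ (where $k=0$ gives the empty set; $A=[d]$ is allowed). Then the corresponding chromatic word-quasisymmetric functions $\Psi(\mathrm{SM}(A))$ are linearly independent. Therefore the rank of the degree-$d$ component $\Psi_d\colon\mathrm{Mat}_d\to\mathrm{WQSym}_d$ of $\Psi$ is at least $2^d-d$.
   Context: $[d]=\{1,\dots,d\}$, $[0]=\emptyset$. For a matroid $M$ on $[d]$, $f\colon[d]\to\mathbb R$ and a basis $B$ put $f(B)=\sum_{i\in B}f(i)$; $f$ is $M$-generic if there is a unique basis $B$ of $M$ maximizing $f(B)$. Let $w_1,w_2,\dots$ be non-commuting variables and $w_f=w_{f(1)}\cdots w_{f(d)}$ for $f\colon[d]\to\mathbb Z_{\ge1}$. The chromatic word-quasisymmetric function of $M$ is $\Psi(M)=\sum_{f} w_f$, the sum over all $M$-generic $f\colon[d]\to\mathbb Z_{\ge 1}$. The set composition type of $f$ is the ordered partition of $[d]$ into the level sets of $f$, listed by increasing value. $\mathrm{WQSym}_d$ is the real vector space of formal series $\sum_{f:[d]\to\mathbb Z_{\ge1}}c_fw_f$ with $c_f=c_g$ whenever $f,g$ have the same set composition type. $\mathrm{Mat}_d$ is the real vector space with basis all matroids on $[d]$, and $\Psi_d$ is the linear extension of $M\mapsto\Psi(M)$. For $A=\{a_1<\dots<a_r\}\subseteq[d]$, the Schubert matroid $\mathrm{SM}(A)$ is the matroid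 on $[d]$ whose bases are the sets $B=\{b_1<\dots<b_r\}\subseteq[d]$ with $b_i\le a_i$ for all $i=1,\dots,r$. *)

theory Defs
  imports "HOL-Analysis.Analysis" "HOL-Analysis.Finite_Function_Topology" "HOL-Library.Function_Algebras"
begin

text \<open>Pointwise real vector space structure on functions (addition is the one of
  \<^theory>\<open>HOL-Library.Function_Algebras\<close>).\<close>

instantiation "fun" :: (type, real_vector) real_vector
begin

definition scaleR_fun_def: "c *\<^sub>R f = (\<lambda>x. c *\<^sub>R f x)"

instance
  by standard (auto simp: scaleR_fun_def fun_eq_iff scaleR_add_right scaleR_add_left)

end

lemma scaleR_fun_apply [simp]: "(c *\<^sub>R f) x = c *\<^sub>R f x"
  by (simp add: scaleR_fun_def)


section \<open>Matroids\<close>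

text \<open>A matroid on a finite ground set \<open>E\<close> is represented by its set of bases.\<close>

definition matroid_on :: "'a set \<Rightarrow> 'a set set \<Rightarrow> bool" where
  "matroid_on E M \<longleftrightarrow> finite E \<and> M \<noteq> {} \<and> M \<subseteq> Pow E \<and>
     (\<forall>B\<in>M. \<forall>C\<in>M. \<forall>x\<in>B - C. \<exists>y\<in>C - B. insert y (B - {x}) \<in> M)"

definition generic :: "'a set set \<Rightarrow> ('a \<Rightarrow> real) \<Rightarrow> bool" where
  "generic M f \<longleftrightarrow> (\<exists>!B. B \<in> M \<and> (\<forall>C\<in>M. sum f C \<le> sum f B))"

text \<open>For finite \<open>S\<close>, \<open>sorted_list_of_set S ! i\<close> is the element of \<open>S\<close> of rank \<open>i\<close>, counted from \<open>0\<close>.\<close>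

definition schubert :: "nat \<Rightarrow> nat set \<Rightarrow> nat set set" where
  "schubert d A = {B. B \<subseteq> {1..d} \<and> card B = card A \<and>
     (\<forall>i<card A. sorted_list_of_set B ! i \<le> sorted_list_of_set A ! i)}"


definition schubert_index :: "nat \<Rightarrow> nat set set" where
  "schubert_index d = {A. A \<subseteq> {1..d} \<and> (\<forall>k<d. A \<noteq> {1..k})}"


section \<open>Word-quasisymmetric functions\<close>

text \<open>The monomial $w_{i_1} \cdots w_{i_d}$ in the non-commuting variables $w_1, w_2, \dots$ is
  represented by the word \<open>[i\<^sub>1, \<dots>, i\<^sub>d]\<close>, and a formal series in these monomials by its
  coefficient function.\<close>

type_synonym word_series = "nat list \<Rightarrow> real"

definition colorings :: "nat \<Rightarrow> (nat \<Rightarrow> nat) set" where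
  "colorings d = {1..d} \<rightarrow>\<^sub>E {1..}"

definition word_of :: "nat \<Rightarrow> (nat \<Rightarrow> nat) \<Rightarrow> nat list" where
  "word_of d f = map f [1..<Suc d]"

definition set_composition_type :: "nat \<Rightarrow> (nat \<Rightarrow> nat) \<Rightarrow> nat set list" where
  "set_composition_type d f =
     map (\<lambda>v. {i \<in> {1..d}. f i = v}) (sorted_list_of_set (f ` {1..d}))"

definition WQSym :: "nat \<Rightarrow> word_series set" where
  "WQSym d = {c. (\<forall>u. c u \<noteq> 0 \<longrightarrow> u \<in> word_of d ` colorings d) \<and>
     (\<forall>f\<in>colorings d. \<forall>g\<in>colorings d.
        set_composition_type d f = set_composition_type d g \<longrightarrow> c (word_of d f) = c (word_of d g))}"

text \<open>The coefficient of the word \<open>u\<close> in $\sum_f w_f$ is the number of \<open>f\<close> with $w_f = u$.\<close>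

definition Psi :: "nat \<Rightarrow> nat set set \<Rightarrow> word_series" where
  "Psi d M = (\<lambda>u. real (card {f \<in> colorings d. generic M (\<lambda>i. real (f i)) \<and> word_of d f = u}))"

text \<open>\<open>Mat d\<close> is the space of formal real linear combinations of matroids on \<open>{1..d}\<close>.
  Since \<open>{1..d}\<close> carries only finitely many matroids, it is finite-dimensional.\<close>

definition Mat :: "nat \<Rightarrow> (nat set set, real) poly_mapping set" where
  "Mat d = {x. Poly_Mapping.keys x \<subseteq> Collect (matroid_on {1..d})}"

definition Psi_lin :: "nat \<Rightarrow> (nat set set, real) poly_mapping \<Rightarrow> word_series" where
  "Psi_lin d x = (\<Sum>M\<in>Poly_Mapping.keys x. Poly_Mapping.lookup x M *\<^sub>R Psi d M)"


section \<open>Well-definedness\<close>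

lemma sorted_list_of_set_nth_le_iff:
  fixes S :: "nat set"
  assumes "finite S" "i < card S"
  shows "sorted_list_of_set S ! i \<le> k \<longleftrightarrow> i < card (S \<inter> {..k})"
proof -
  define xs where "xs = sorted_list_of_set S"
  have xs: "sorted_wrt (<) xs" "set xs = S" "length xs = card S" "distinct xs"
    using assms by (simp_all add: xs_def)
  have S: "S \<inter> {..k} = (\<lambda>j. xs ! j) ` {j. j < length xs \<and> xs ! j \<le> k}"
    unfolding xs(2)[symmetric] by (auto simp: in_set_conv_nth)
  have inj: "inj_on (\<lambda>j. xs ! j) {j. j < length xs \<and> xs ! j \<le> k}"
    using xs(4) by (auto simp: inj_on_def nth_eq_iff_index_eq)
  have c: "card (S \<inter> {..k}) = card {j. j < length xs \<and> xs ! j \<le> k}"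
    unfolding S by (rule card_image[OF inj])
  have mono: "xs ! a \<le> xs ! b" if "a \<le> b" "b < length xs" for a b
    using sorted_wrt_nth_less[OF xs(1), of a b] that by (cases "a = b") auto
  show ?thesis
  proof
    assume "sorted_list_of_set S ! i \<le> k"
    hence "{..i} \<subseteq> {j. j < length xs \<and> xs ! j \<le> k}"
      using mono[of _ i] assms(2) xs(3) by (fastforce simp: xs_def[symmetric])
    hence "card {..i} \<le> card {j. j < length xs \<and> xs ! j \<le> k}"
      by (intro card_mono) auto
    thus "i < card (S \<inter> {..k})" using c by simp
  next
    assume "i < card (S \<inter> {..k})"
    hence l: "i < card {j. j < length xs \<and> xs ! j \<le> k}" using c by simp
    have "\<not> {j. j < length xs \<and> xs ! j \<le> k} \<subseteq> {..<i}"
      using card_mono[of "{..<i}" "{j. j < length xs \<and> xs ! j \<le> k}"] l by auto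
    then obtain j where "j \<in> {j. j < length xs \<and> xs ! j \<le> k}" "j \<notin> {..<i}" by blast
    hence "j < length xs" "xs ! j \<le> k" "i \<le> j" by simp_all
    thus "sorted_list_of_set S ! i \<le> k"
      using mono[of i j] by (simp add: xs_def[symmetric])
  qed
qed

lemma schubert_iff:
  assumes "A \<subseteq> {1..d}"
  shows "B \<in> schubert d A \<longleftrightarrow> B \<subseteq> {1..d} \<and> card B = card A \<and>
           (\<forall>k. card (A \<inter> {..k}) \<le> card (B \<inter> {..k}))"
proof -
  have "(\<forall>i<card A. sorted_list_of_set B ! i \<le> sorted_list_of_set A ! i) \<longleftrightarrow>
        (\<forall>k. card (A \<inter> {..k}) \<le> card (B \<inter> {..k}))"
    if B: "B \<subseteq> {1..d}" "card B = card A"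
  proof -
    have fin: "finite A" "finite B"
      using assms B(1) finite_subset by auto
    note A_iff = sorted_list_of_set_nth_le_iff[OF fin(1)]
    note B_iff = sorted_list_of_set_nth_le_iff[OF fin(2), unfolded B(2)]
    have le: "card (A \<inter> {..k}) \<le> card A" for k
      using fin by (intro card_mono) auto
    show ?thesis
    proof (intro iffI allI impI)
      fix k
      assume *: "\<forall>i<card A. sorted_list_of_set B ! i \<le> sorted_list_of_set A ! i"
      show "card (A \<inter> {..k}) \<le> card (B \<inter> {..k})"
      proof (cases "card (A \<inter> {..k})")
        case (Suc i)
        hence i: "i < card A" using le[of k] by simp
        have "sorted_list_of_set A ! i \<le> k" using A_iff[OF i] Suc by simp
        hence "sorted_list_of_set B ! i \<le> k" using * i by (meson le_trans)
        thus ?thesis using B_iff[OF i] Suc by simp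
      qed simp
    next
      fix i
      assume *: "\<forall>k. card (A \<inter> {..k}) \<le> card (B \<inter> {..k})" and i: "i < card A"
      have "i < card (A \<inter> {..sorted_list_of_set A ! i})" using A_iff[OF i] by blast
      thus "sorted_list_of_set B ! i \<le> sorted_list_of_set A ! i"
        using B_iff[OF i] * by (meson less_le_trans)
    qed
  qed
  thus ?thesis unfolding schubert_def by auto
qed

lemma matroid_schubert:
  assumes "A \<subseteq> {1..d}"
  shows "matroid_on {1..d} (schubert d A)"
  unfolding matroid_on_def
proof (intro conjI ballI)
  show "schubert d A \<noteq> {}" "schubert d A \<subseteq> Pow {1..d}"
    using assms unfolding schubert_def by auto
  fix B C x
  assume BC: "B \<in> schubert d A" "C \<in> schubert d A" and x: "x \<in> B - C"
  note iff = schubert_iff[OF assms]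
  have B: "B \<subseteq> {1..d}" "card B = card A" "\<And>k. card (A \<inter> {..k}) \<le> card (B \<inter> {..k})"
    and C: "C \<subseteq> {1..d}" "card C = card A" "\<And>k. card (A \<inter> {..k}) \<le> card (C \<inter> {..k})"
    using BC iff by auto
  have fin: "finite B" "finite C" using B(1) C(1) finite_subset by auto
  have "C - B \<noteq> {}"
    using card_subset_eq[of B C] fin B(2) C(2) x by auto
  define y where "y = Min (C - B)"
  have y: "y \<in> C - B" and y_min: "\<And>z. z \<in> C - B \<Longrightarrow> y \<le> z"
    unfolding y_def using \<open>C - B \<noteq> {}\<close> fin Min_in[of "C - B"] by auto
  let ?D = "insert y (B - {x})"
  have cardD: "card ?D = card A"
    using x y fin B(2) by (metis DiffD1 DiffD2 card_Suc_Diff1 card_insert_disjoint finite_Diff)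
  have "card (A \<inter> {..k}) \<le> card (?D \<inter> {..k})" for k
  proof -
    consider "k < x" | "x \<le> k" "y \<le> k" | "x \<le> k" "k < y" by linarith
    thus ?thesis
    proof cases
      case 1
      hence "B \<inter> {..k} \<subseteq> ?D \<inter> {..k}" by auto
      hence "card (B \<inter> {..k}) \<le> card (?D \<inter> {..k})" using fin by (intro card_mono) auto
      thus ?thesis using B(3)[of k] by linarith
    next
      case 2
      hence "?D \<inter> {..k} = insert y (B \<inter> {..k} - {x})" by auto
      moreover have "card (insert y (B \<inter> {..k} - {x})) = Suc (card (B \<inter> {..k} - {x}))"
        using y fin by (intro card_insert_disjoint) auto
      moreover have "Suc (card (B \<inter> {..k} - {x})) = card (B \<inter> {..k})"
        using x 2 fin by (intro card_Suc_Diff1) auto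
      ultimately show ?thesis using B(3)[of k] by simp
    next
      case 3
      hence "C \<inter> {..k} \<subseteq> ?D \<inter> {..k}" using y_min x by fastforce
      hence "card (C \<inter> {..k}) \<le> card (?D \<inter> {..k})" using fin by (intro card_mono) auto
      thus ?thesis using C(3)[of k] by linarith
    qed
  qed
  hence "?D \<in> schubert d A" using iff cardD B(1) C(1) y by auto
  thus "\<exists>y\<in>C - B. insert y (B - {x}) \<in> schubert d A" using y by blast
qed simp

lemma inj_on_word_of: "inj_on (word_of d) (colorings d)"
proof (rule inj_onI)
  fix f g assume fg: "f \<in> colorings d" "g \<in> colorings d" "word_of d f = word_of d g"
  have "f i = g i" for i
  proof (cases "i \<in> {1..d}")
    case True
    thus ?thesis using fg(3) by (auto simp: word_of_def)
  next
    case False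
    thus ?thesis using fg(1,2) unfolding colorings_def by (metis PiE_arb)
  qed
  thus "f = g" by (rule ext)
qed

lemma Psi_word_of:
  assumes "f \<in> colorings d"
  shows "Psi d M (word_of d f) = (if generic M (\<lambda>i. real (f i)) then 1 else 0)"
proof -
  have "{g \<in> colorings d. generic M (\<lambda>i. real (g i)) \<and> word_of d g = word_of d f}
        = (if generic M (\<lambda>i. real (f i)) then {f} else {})"
    using assms inj_on_word_of[of d] by (auto simp: inj_on_def)
  thus ?thesis by (simp add: Psi_def)
qed

lemma linear_Psi_lin: "linear (Psi_lin d)"
proof -
  have sup: "Psi_lin d x = (\<Sum>M\<in>K. Poly_Mapping.lookup x M *\<^sub>R Psi d M)"
    if "finite K" "Poly_Mapping.keys x \<subseteq> K" for x K
    unfolding Psi_lin_def using that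
    by (intro sum.mono_neutral_left) (auto simp: in_keys_iff)
  have lookup_scaleR: "Poly_Mapping.lookup (c *\<^sub>R x) M = c * Poly_Mapping.lookup x M"
    for c and x :: "(nat set set, real) poly_mapping" and M
    by (simp add: scaleR_poly_mapping_def)
  show ?thesis
  proof (rule linearI)
    fix x y :: "(nat set set, real) poly_mapping"
    let ?K = "Poly_Mapping.keys x \<union> Poly_Mapping.keys y"
    have "Psi_lin d (x + y) = (\<Sum>M\<in>?K. Poly_Mapping.lookup (x + y) M *\<^sub>R Psi d M)"
      by (rule sup) (auto dest: subsetD[OF Poly_Mapping.keys_add])
    also have "\<dots> = Psi_lin d x + Psi_lin d y"
      by (simp add: sup[of ?K x] sup[of ?K y] lookup_add scaleR_add_left sum.distrib)
    finally show "Psi_lin d (x + y) = Psi_lin d x + Psi_lin d y" .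
  next
    fix c and x :: "(nat set set, real) poly_mapping"
    have "Psi_lin d (c *\<^sub>R x) =
        (\<Sum>M\<in>Poly_Mapping.keys x. Poly_Mapping.lookup (c *\<^sub>R x) M *\<^sub>R Psi d M)"
      by (rule sup) (auto simp: in_keys_iff lookup_scaleR)
    thus "Psi_lin d (c *\<^sub>R x) = c *\<^sub>R Psi_lin d x"
      by (simp add: lookup_scaleR Psi_lin_def scaleR_sum_right)
  qed
qed

lemma Psi_lin_single: "Psi_lin d (Poly_Mapping.single M 1) = Psi d M"
  by (simp add: Psi_lin_def)

text \<open>Genericity depends only on the relative order of the values of \<open>f\<close>.\<close>

lemma unique_max_iff:
  assumes M: "matroid_on E M" and B: "B \<in> M"
  shows "(\<forall>C\<in>M - {B}. sum f C < sum f B) \<longleftrightarrow>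
         (\<forall>x\<in>B. \<forall>y\<in>E - B. insert y (B - {x}) \<in> M \<longrightarrow> f y < (f x :: real))"
    (is "?L \<longleftrightarrow> ?R")
proof
  have finE: "finite E" and sub: "\<And>C. C \<in> M \<Longrightarrow> C \<subseteq> E"
    and ex: "\<And>B C x. B \<in> M \<Longrightarrow> C \<in> M \<Longrightarrow> x \<in> B - C \<Longrightarrow> \<exists>y\<in>C - B. insert y (B - {x}) \<in> M"
    using M unfolding matroid_on_def by blast+
  have fin: "finite C" if "C \<in> M" for C using sub[OF that] finE finite_subset by auto
  have swap: "sum f (insert y (C - {x})) = sum f C - f x + f y"
    if "C \<in> M" "x \<in> C" "y \<notin> C" for C x y
    using that fin[OF that(1)] by (simp add: sum_diff1)
  {
    assume L: ?L
    show ?R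
    proof (intro ballI impI)
      fix x y assume xy: "x \<in> B" "y \<in> E - B" "insert y (B - {x}) \<in> M"
      hence "insert y (B - {x}) \<noteq> B" by auto
      hence "sum f (insert y (B - {x})) < sum f B" using L xy by auto
      thus "f y < f x" using swap[OF B, of x y] xy by auto
    qed
  next
    assume R: ?R
    have finM: "finite M" using finE sub by (intro finite_subset[of M "Pow E"]) auto
    have max_eq: "C = B" if C: "C \<in> M" "\<And>D. D \<in> M \<Longrightarrow> sum f D \<le> sum f C" for C
    proof (rule ccontr)
      assume "C \<noteq> B"
      have "B - C \<noteq> {}"
      proof
        assume BC: "B - C = {}"
        then obtain z where "z \<in> C - B" using \<open>C \<noteq> B\<close> by blast
        from ex[OF C(1) B this] BC show False by blast
      qed
      moreover have "finite (B - C)" using fin[OF B] by auto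
      ultimately obtain x where x: "x \<in> B - C" and x_min: "\<And>z. z \<in> B - C \<Longrightarrow> f x \<le> f z"
        using ex_min_if_finite[of "f ` (B - C)"] by (fastforce simp: not_less)
      obtain y where y: "y \<in> C - B" "insert y (B - {x}) \<in> M" using ex[OF B C(1) x] by blast
      have "f y < f x" using R x y sub[OF C(1)] by blast
      obtain z where z: "z \<in> B - C" "insert z (C - {y}) \<in> M" using ex[OF C(1) B y(1)] by blast
      have "sum f (insert z (C - {y})) = sum f C - f y + f z"
        using swap[OF C(1), of y z] y z by auto
      thus False using C(2)[OF z(2)] x_min[OF z(1)] \<open>f y < f x\<close> by linarith
    qed
    have "finite (sum f ` M)" "sum f ` M \<noteq> {}" using finM B by auto
    from Max_in[OF this] obtain C where C: "C \<in> M" "sum f C = Max (sum f ` M)" by auto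
    have C_max: "sum f D \<le> sum f C" if "D \<in> M" for D
      using that finM C(2) by auto
    hence "C = B" using max_eq C(1) by blast
    show ?L
    proof
      fix D assume D: "D \<in> M - {B}"
      have "sum f D \<noteq> sum f B"
        using max_eq[of D] D C_max \<open>C = B\<close> by auto
      thus "sum f D < sum f B" using C_max[of D] D \<open>C = B\<close> by auto
    qed
  }
qed

lemma generic_cong:
  assumes M: "matroid_on E M"
    and fg: "\<And>x y. x \<in> E \<Longrightarrow> y \<in> E \<Longrightarrow> f x < f y \<longleftrightarrow> g x < g y"
  shows "generic M f \<longleftrightarrow> generic M g"
proof -
  have sub: "\<And>C. C \<in> M \<Longrightarrow> C \<subseteq> E" using M unfolding matroid_on_def by blast
  have gen: "generic M h \<longleftrightarrow> (\<exists>B\<in>M. \<forall>C\<in>M - {B}. sum h C < sum h B)" for h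
  proof
    assume "generic M h"
    then obtain B where BM: "B \<in> M \<and> (\<forall>C\<in>M. sum h C \<le> sum h B)"
      and uniq': "\<forall>D. D \<in> M \<and> (\<forall>C\<in>M. sum h C \<le> sum h D) \<longrightarrow> D = B"
      unfolding generic_def by (rule ex1E)
    have B: "B \<in> M" "\<And>C. C \<in> M \<Longrightarrow> sum h C \<le> sum h B" using BM by blast+
    have uniq: "D = B" if "D \<in> M" "\<forall>C\<in>M. sum h C \<le> sum h D" for D
      using uniq' that by blast
    have "sum h C < sum h B" if C: "C \<in> M - {B}" for C
    proof (rule ccontr)
      assume "\<not> sum h C < sum h B"
      hence "\<forall>D\<in>M. sum h D \<le> sum h C" using B(2) by force
      thus False using uniq[of C] C by blast
    qed
    thus "\<exists>B\<in>M. \<forall>C\<in>M - {B}. sum h C < sum h B" using B(1) by blast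
  next
    assume "\<exists>B\<in>M. \<forall>C\<in>M - {B}. sum h C < sum h B"
    then obtain B where B: "B \<in> M" "\<And>C. C \<in> M - {B} \<Longrightarrow> sum h C < sum h B" by blast
    show "generic M h" unfolding generic_def
    proof (rule ex1I[of _ B])
      show "B \<in> M \<and> (\<forall>C\<in>M. sum h C \<le> sum h B)"
        using B by force
      show "D = B" if "D \<in> M \<and> (\<forall>C\<in>M. sum h C \<le> sum h D)" for D
        using that B by force
    qed
  qed
  have "(\<forall>C\<in>M - {B}. sum f C < sum f B) \<longleftrightarrow> (\<forall>C\<in>M - {B}. sum g C < sum g B)"
    if B: "B \<in> M" for B
    unfolding unique_max_iff[OF M B] using fg sub[OF B] by (meson DiffD1 subsetD)
  thus ?thesis unfolding gen by blast
qed

lemma set_composition_type_less: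
  assumes eq: "set_composition_type d f = set_composition_type d g"
    and ij: "i \<in> {1..d}" "j \<in> {1..d}"
  shows "f i < f j \<longleftrightarrow> g i < g j"
proof -
  define L where "L = set_composition_type d f"
  have pos: "\<exists>p q. p < length L \<and> q < length L \<and> i \<in> L ! p \<and> j \<in> L ! q \<and>
      (\<forall>r<length L. i \<in> L ! r \<longrightarrow> r = p) \<and> (\<forall>r<length L. j \<in> L ! r \<longrightarrow> r = q) \<and>
      (h i < h j \<longleftrightarrow> p < q)" if h: "L = set_composition_type d h" for h
  proof -
    define vs where "vs = sorted_list_of_set (h ` {1..d})"
    have vs: "sorted_wrt (<) vs" "set vs = h ` {1..d}" "distinct vs" by (simp_all add: vs_def)
    have L: "length L = length vs" "\<And>r. r < length vs \<Longrightarrow> L ! r = {k \<in> {1..d}. h k = vs ! r}"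
      unfolding h set_composition_type_def vs_def by auto
    obtain p q where p: "p < length vs" "vs ! p = h i" and q: "q < length vs" "vs ! q = h j"
      using vs(2) ij by (metis image_eqI in_set_conv_nth)
    have "h i < h j \<longleftrightarrow> p < q"
      using sorted_wrt_nth_less[OF vs(1), of p q] sorted_wrt_nth_less[OF vs(1), of q p] p q
      by (metis linorder_neqE_nat order_less_asym order_less_irrefl)
    moreover have "\<forall>r<length L. i \<in> L ! r \<longrightarrow> r = p"
    proof (intro allI impI)
      fix r assume r: "r < length L" "i \<in> L ! r"
      hence "vs ! r = vs ! p" using L(2)[of r] L(1) p(2) by simp
      thus "r = p" using nth_eq_iff_index_eq[OF vs(3), of r p] r(1) L(1) p(1) by simp
    qed
    moreover have "\<forall>r<length L. j \<in> L ! r \<longrightarrow> r = q"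
    proof (intro allI impI)
      fix r assume r: "r < length L" "j \<in> L ! r"
      hence "vs ! r = vs ! q" using L(2)[of r] L(1) q(2) by simp
      thus "r = q" using nth_eq_iff_index_eq[OF vs(3), of r q] r(1) L(1) q(1) by simp
    qed
    moreover have "p < length L" "q < length L" "i \<in> L ! p" "j \<in> L ! q"
      using p q ij L by simp_all
    ultimately show ?thesis by blast
  qed
  obtain p q where "p < length L" "q < length L" "i \<in> L ! p" "j \<in> L ! q" "f i < f j \<longleftrightarrow> p < q"
    using pos[OF L_def] by (elim exE conjE) (rule that)
  moreover obtain p' q' where
    "\<forall>r<length L. i \<in> L ! r \<longrightarrow> r = p'" "\<forall>r<length L. j \<in> L ! r \<longrightarrow> r = q'" "g i < g j \<longleftrightarrow> p' < q'"
    using pos[OF L_def[unfolded eq]] by (elim exE conjE) (rule that)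
  ultimately show ?thesis by metis
qed

lemma Psi_in_WQSym:
  assumes "matroid_on {1..d} M"
  shows "Psi d M \<in> WQSym d"
  unfolding WQSym_def
proof (intro CollectI conjI allI impI ballI)
  fix u assume "Psi d M u \<noteq> 0"
  hence "{f \<in> colorings d. generic M (\<lambda>i. real (f i)) \<and> word_of d f = u} \<noteq> {}"
    unfolding Psi_def by (metis card.empty of_nat_0)
  thus "u \<in> word_of d ` colorings d" by auto
next
  fix f g assume fg: "f \<in> colorings d" "g \<in> colorings d"
    and eq: "set_composition_type d f = set_composition_type d g"
  have "generic M (\<lambda>i. real (f i)) \<longleftrightarrow> generic M (\<lambda>i. real (g i))"
    using set_composition_type_less[OF eq] by (intro generic_cong[OF assms]) auto
  thus "Psi d M (word_of d f) = Psi d M (word_of d g)" using fg by (simp add: Psi_word_of)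
qed

lemma subspace_WQSym: "subspace (WQSym d)"
proof (rule subspaceI)
  show "0 \<in> WQSym d" by (simp add: WQSym_def)
next
  fix a b assume a: "a \<in> WQSym d" and b: "b \<in> WQSym d"
  have "u \<in> word_of d ` colorings d" if "(a + b) u \<noteq> 0" for u
  proof -
    have "a u \<noteq> 0 \<or> b u \<noteq> 0" using that by auto
    thus ?thesis using a b unfolding WQSym_def by blast
  qed
  moreover have "(a + b) (word_of d f) = (a + b) (word_of d g)"
    if "f \<in> colorings d" "g \<in> colorings d"
      "set_composition_type d f = set_composition_type d g" for f g
  proof -
    have "a (word_of d f) = a (word_of d g)" "b (word_of d f) = b (word_of d g)"
      using a b that unfolding WQSym_def by blast+
    thus ?thesis by simp
  qed
  ultimately show "a + b \<in> WQSym d" unfolding WQSym_def by blast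
next
  fix c :: real and a assume "a \<in> WQSym d"
  hence a: "\<forall>u. a u \<noteq> 0 \<longrightarrow> u \<in> word_of d ` colorings d"
    "\<forall>f\<in>colorings d. \<forall>g\<in>colorings d.
       set_composition_type d f = set_composition_type d g \<longrightarrow> a (word_of d f) = a (word_of d g)"
    unfolding WQSym_def by blast+
  have "(c *\<^sub>R a) u \<noteq> 0 \<Longrightarrow> a u \<noteq> 0" for u by auto
  moreover have "a u = a v \<Longrightarrow> (c *\<^sub>R a) u = (c *\<^sub>R a) v" for u v by simp
  ultimately show "c *\<^sub>R a \<in> WQSym d" unfolding WQSym_def using a by blast
qed

lemma subspace_Mat: "subspace (Mat d)"
proof -
  have "Mat d = {x. \<forall>M. \<not> matroid_on {1..d} M \<longrightarrow> Poly_Mapping.lookup x M = 0}"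
    unfolding Mat_def by (auto simp: in_keys_iff)
  thus ?thesis by (auto simp: subspace_def lookup_add scaleR_poly_mapping_def)
qed

lemma Psi_lin_Mat: "Psi_lin d ` Mat d \<subseteq> WQSym d"
proof (rule image_subsetI)
  fix x assume "x \<in> Mat d"
  thus "Psi_lin d x \<in> WQSym d" unfolding Psi_lin_def Mat_def
    by (intro subspace_sum[OF subspace_WQSym] subspace_scale[OF subspace_WQSym] Psi_in_WQSym) blast
qed

end

theory Submission
  imports Defs
begin

text \<open>An injective \<open>f\<close> is generic for every matroid, so the coefficients of a vanishing linear
  combination of the \<open>Psi d (schubert d A)\<close> sum to zero. If \<open>A\<close> is not an initial segment, let
  \<open>j = Max A\<close> and let \<open>i < j\<close> be the least positive non-element of \<open>A\<close>. Let \<open>f\<close> be large on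
  \<open>A - {j}\<close>, intermediate on \<open>i\<close> and \<open>j\<close>, small elsewhere, with \<open>f i = f j\<close> the only coincidence of
  values. Then \<open>f\<close> is not generic for \<open>schubert d A\<close>, and if \<open>f\<close> is not generic for
  \<open>schubert d A'\<close> then \<open>A\<close> is a basis of \<open>schubert d A'\<close>: of two maximal bases that differ by
  exchanging \<open>i\<close> and \<open>j\<close>, the one containing \<open>j\<close> must be \<open>A\<close>, since \<open>j\<close> is larger than all
  of \<open>A - {j}\<close> and \<open>i\<close> is smaller than everything outside \<open>A\<close>. The matrix of non-genericity is
  therefore unitriangular for inclusion of Schubert matroids.\<close>

section \<open>Non-generic functions\<close>

text \<open>A maximal basis \<open>B\<close> that is not the only one violates the local criterion
  \<open>unique_max_iff\<close>: some exchange has \<open>f x \<le> f y\<close>. Maximality of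
  \<open>B\<close> gives the reverse inequality.\<close>

lemma not_generic_obtains_tie:
  assumes M: "matroid_on E M" and ng: "\<not> generic M f"
  obtains B x y where "B \<in> M" "\<And>C. C \<in> M \<Longrightarrow> sum f C \<le> sum f B"
    "x \<in> B" "y \<in> E - B" "insert y (B - {x}) \<in> M" "f x = f y"
proof -
  have fE: "finite E" and ne: "M \<noteq> {}" and sub: "M \<subseteq> Pow E"
    using M unfolding matroid_on_def by auto
  have finM: "finite M" using fE sub finite_subset by auto
  have "Max (sum f ` M) \<in> sum f ` M" using finM ne by (intro Max_in) auto
  then obtain B where B: "B \<in> M" "sum f B = Max (sum f ` M)" by auto
  have mx: "sum f C \<le> sum f B" if "C \<in> M" for C using that finM B(2) by auto
  have "\<not> (\<forall>C\<in>M - {B}. sum f C < sum f B)"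
  proof
    assume *: "\<forall>C\<in>M - {B}. sum f C < sum f B"
    have "generic M f" unfolding generic_def
    proof (rule ex1I[of _ B])
      show "B \<in> M \<and> (\<forall>C\<in>M. sum f C \<le> sum f B)" using B(1) mx by blast
      show "D = B" if "D \<in> M \<and> (\<forall>C\<in>M. sum f C \<le> sum f D)" for D
        using that * B(1) by (metis Diff_iff leD singletonD)
    qed
    thus False using ng by blast
  qed
  then obtain x y where xy: "x \<in> B" "y \<in> E - B" "insert y (B - {x}) \<in> M" "f x \<le> f y"
    unfolding unique_max_iff[OF M B(1)] by (auto simp: not_less)
  have "finite B" using B(1) sub fE finite_subset by blast
  hence "sum f (insert y (B - {x})) = sum f B - f x + f y"
    using xy by (simp add: sum_diff1)
  with mx[OF xy(3)] xy(4) have "f x = f y" by linarith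
  with that[OF B(1) mx xy(1-3)] show thesis by blast
qed

lemma generic_if_inj_on:
  assumes "matroid_on E M" "inj_on f E"
  shows "generic M f"
proof (rule ccontr)
  assume "\<not> generic M f"
  then obtain B x y where B: "B \<in> M" "x \<in> B" "y \<in> E - B" "f x = f y"
    using not_generic_obtains_tie[OF assms(1)] by metis
  hence "x \<in> E" using assms(1) unfolding matroid_on_def by blast
  thus False using B inj_onD[OF assms(2)] by blast
qed

text \<open>Colorings are extensional functions; restricting allows evaluation at functions given by
  a formula on all of \<open>nat\<close>.\<close>

lemma Psi_restrict:
  assumes "matroid_on {1..d} M" "\<And>i. i \<in> {1..d} \<Longrightarrow> 1 \<le> f i"
  shows "Psi d M (word_of d (restrict f {1..d})) = of_bool (generic M (\<lambda>i. real (f i)))"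
proof -
  have "restrict f {1..d} \<in> colorings d" using assms(2) unfolding colorings_def by auto
  moreover have "generic M (\<lambda>i. real (restrict f {1..d} i)) \<longleftrightarrow> generic M (\<lambda>i. real (f i))"
    by (rule generic_cong[OF assms(1)]) auto
  ultimately show ?thesis by (simp add: Psi_word_of)
qed

section \<open>Schubert matroids\<close>

text \<open>Moving an element down never decreases the counts
  \<open>card (B \<inter> {..k})\<close>, which decide membership by
  \<open>schubert_iff\<close>.\<close>

lemma schubert_exchange_smaller:
  assumes A: "A \<subseteq> {1..d}" and B: "B \<in> schubert d A"
    and xy: "x \<in> B" "y \<notin> B" "1 \<le> y" "y < x"
  shows "insert y (B - {x}) \<in> schubert d A"
proof -
  let ?D = "insert y (B - {x})"
  have B': "B \<subseteq> {1..d}" "card B = card A" "\<And>k. card (A \<inter> {..k}) \<le> card (B \<inter> {..k})"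
    using B schubert_iff[OF A] by auto
  have fin: "finite B" using B'(1) finite_subset by auto
  have "card (B \<inter> {..k}) \<le> card (?D \<inter> {..k})" for k
  proof (cases "k < x")
    case True
    thus ?thesis using fin by (intro card_mono) auto
  next
    case False
    hence "?D \<inter> {..k} = insert y (B \<inter> {..k} - {x})" using xy by auto
    moreover have "card (insert y (B \<inter> {..k} - {x})) = Suc (card (B \<inter> {..k} - {x}))"
      using xy fin by (intro card_insert_disjoint) auto
    moreover have "Suc (card (B \<inter> {..k} - {x})) = card (B \<inter> {..k})"
      using xy False fin by (intro card_Suc_Diff1) auto
    ultimately show ?thesis by simp
  qed
  moreover have "card ?D = card B"
    using xy fin by (metis DiffD1 card_Suc_Diff1 card_insert_disjoint finite_Diff)
  moreover have "?D \<subseteq> {1..d}" using B'(1) xy by fastforce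
  ultimately show ?thesis unfolding schubert_iff[OF A]
    using B' le_trans by metis
qed

text \<open>On subsets of \<open>{1..d}\<close>, \<open>A \<in> schubert d A'\<close> is the
  componentwise (Gale) order. This lemma and the next two are its reflexivity, transitivity and
  antisymmetry.\<close>

lemma schubert_refl: "A \<subseteq> {1..d} \<Longrightarrow> A \<in> schubert d A"
  by (simp add: schubert_def)

lemma schubert_subset:
  assumes "A \<in> schubert d A'"
  shows "schubert d A \<subseteq> schubert d A'"
  using assms unfolding schubert_def by (auto intro: le_trans)

lemma schubert_antisym:
  assumes "A \<in> schubert d A'" "A' \<in> schubert d A"
  shows "A = A'"
proof -
  have fin: "finite A" "finite A'" and card: "card A = card A'"
    using assms finite_subset unfolding schubert_def by auto
  have "sorted_list_of_set A = sorted_list_of_set A'"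
    using assms card unfolding schubert_def by (intro nth_equalityI) (auto intro: le_antisym)
  thus ?thesis using fin by (metis set_sorted_list_of_set)
qed

text \<open>Used with \<open>S = A - {j}\<close>. On \<open>{1..d}\<close> the values form three
  bands: at most \<open>d\<close>, exactly \<open>d + 1\<close>, at least \<open>d + 2\<close>. The
  summand \<open>x\<close> keeps values within the outer bands distinct.\<close>

definition tie_coloring :: "nat \<Rightarrow> nat set \<Rightarrow> nat \<Rightarrow> nat \<Rightarrow> nat \<Rightarrow> nat" where
  "tie_coloring d S i j x = (if x \<in> S then d + 1 + x else if x = i \<or> x = j then d + 1 else x)"

lemma tie_coloring_eq_imp:
  assumes "tie_coloring d S i j x = tie_coloring d S i j y" "x \<in> {1..d}" "y \<in> {1..d}" "x \<noteq> y"
  shows "{x, y} = {i, j}"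
  using assms by (auto simp: tie_coloring_def split: if_splits)

lemma not_generic_tie_coloring_self:
  assumes A: "A \<subseteq> {1..d}" and ij: "j \<in> A" "i \<notin> A" "1 \<le> i" "i < j"
  shows "\<not> generic (schubert d A) (\<lambda>x. real (tie_coloring d (A - {j}) i j x))"
proof
  let ?f = "\<lambda>x. real (tie_coloring d (A - {j}) i j x)"
  let ?A' = "insert i (A - {j})"
  assume "generic (schubert d A) ?f"
  moreover have "A \<in> schubert d A" using A by (rule schubert_refl)
  moreover have "?A' \<in> schubert d A"
    using ij A by (intro schubert_exchange_smaller schubert_refl)
  moreover have fin: "finite A" using A finite_subset by auto
  have "?f i = ?f j" using ij by (simp add: tie_coloring_def)
  hence "sum ?f ?A' = sum ?f A" using ij fin by (simp add: sum_diff1)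
  moreover have "sum ?f C \<le> sum ?f A" if "C \<in> schubert d A" for C
  proof -
    have C: "C \<subseteq> {1..d}" "card C = card A" using that unfolding schubert_def by auto
    have finC: "finite C" using C(1) finite_subset by auto
    have "card (C - A) = card (A - C)"
      using card_Int_Diff[OF fin, of C] card_Int_Diff[OF finC, of A] C(2) by (simp add: Int_commute)
    \<comment> \<open>The value \<open>d + 1\<close> separates: elements of \<open>A\<close> have at
      least this value, elements of \<open>{1..d} - A\<close> at most this value.\<close>
    moreover have "sum ?f (C - A) \<le> real (card (C - A)) * real (d + 1)"
      using C(1) by (intro sum_bounded_above) (auto simp: tie_coloring_def)
    moreover have "real (card (A - C)) * real (d + 1) \<le> sum ?f (A - C)"
      by (intro sum_bounded_below) (auto simp: tie_coloring_def)
    ultimately have "sum ?f (C - A) \<le> sum ?f (A - C)" by simp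
    thus ?thesis
      using sum.Int_Diff[OF fin, of ?f C] sum.Int_Diff[OF finC, of ?f A] by (simp add: Int_commute)
  qed
  ultimately have "?A' = A" unfolding generic_def by (metis (no_types, lifting))
  thus False using ij by blast
qed

lemma not_generic_tie_coloring_imp:
  assumes A: "A \<subseteq> {1..d}" and A': "A' \<subseteq> {1..d}"
    and j: "j \<in> A" "\<And>x. x \<in> A \<Longrightarrow> x \<le> j" and ij: "i < j"
    and i: "i \<notin> A" "1 \<le> i" "\<And>x. 1 \<le> x \<Longrightarrow> x < i \<Longrightarrow> x \<in> A"
    and ng: "\<not> generic (schubert d A') (\<lambda>x. real (tie_coloring d (A - {j}) i j x))"
  shows "A \<in> schubert d A'"
proof -
  let ?f = "\<lambda>x. real (tie_coloring d (A - {j}) i j x)"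
  let ?M = "schubert d A'"
  have sub: "C \<subseteq> {1..d}" if "C \<in> ?M" for C using that unfolding schubert_def by auto
  have fin: "finite C" if "C \<in> ?M" for C using sub[OF that] finite_subset by auto
  have swap: "sum ?f (insert y (C - {x})) = sum ?f C - ?f x + ?f y"
    if "C \<in> ?M" "x \<in> C" "y \<notin> C" for C x y
    using that fin[OF that(1)] by (simp add: sum_diff1)
  obtain B x y where B: "B \<in> ?M" "\<And>C. C \<in> ?M \<Longrightarrow> sum ?f C \<le> sum ?f B"
    and xy: "x \<in> B" "y \<in> {1..d} - B" "insert y (B - {x}) \<in> ?M" "?f x = ?f y"
    using not_generic_obtains_tie[OF matroid_schubert[OF A'] ng] by metis
  have "{x, y} = {i, j}"
    using xy sub[OF B(1)] by (intro tie_coloring_eq_imp[of d "A - {j}" i j x y]) auto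
  hence cases: "x = j \<and> y = i \<or> x = i \<and> y = j" by (auto simp: doubleton_eq_iff)
  obtain D where D: "D \<in> ?M" "\<And>C. C \<in> ?M \<Longrightarrow> sum ?f C \<le> sum ?f D" "j \<in> D" "i \<notin> D"
  proof (cases "x = j")
    case True
    thus thesis using cases xy ij by (intro that[OF B]) auto
  next
    case False
    hence "x = i" "y = j" using cases by auto
    moreover have "sum ?f (insert y (B - {x})) = sum ?f B"
      using swap[OF B(1), of x y] xy by simp
    ultimately show thesis using xy ij B(2) by (intro that[OF xy(3)]) auto
  qed
  \<comment> \<open>Only downward exchanges are sure to stay in the matroid, whence the choice of
    \<open>j\<close> as maximum of \<open>A\<close> and \<open>i\<close> as least gap.\<close>
  have max: "?f y \<le> ?f x" if "x \<in> D" "y \<notin> D" "1 \<le> y" "y < x" for x y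
    using D(2)[OF schubert_exchange_smaller[OF A' D(1) that]] swap[OF D(1) that(1,2)] by linarith
  have "A \<subseteq> D"
  proof (rule subsetI, rule ccontr)
    fix s assume s: "s \<in> A" "s \<notin> D"
    hence "s \<noteq> j" using D(3) by auto
    hence "s < j" "1 \<le> s" using s(1) j(2)[of s] A by auto
    \<comment> \<open>Here \<open>s\<close> could replace the larger \<open>j\<close>, yet its value
      is in the top band.\<close>
    hence "?f s \<le> ?f j" using max D(3) s(2) by blast
    thus False using s(1) \<open>s \<noteq> j\<close> \<open>1 \<le> s\<close> by (auto simp: tie_coloring_def)
  qed
  moreover have "D \<subseteq> A"
  proof (rule subsetI, rule ccontr)
    fix z assume z: "z \<in> D" "z \<notin> A"
    hence z': "z \<noteq> i" "z \<noteq> j" "1 \<le> z" "z \<le> d" using D(4) j(1) sub[OF D(1)] by auto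
    hence "i < z" using i(3)[of z] z(2) by linarith
    \<comment> \<open>Here \<open>i\<close>, of value \<open>d + 1\<close>, could replace
      \<open>z\<close>, whose value is at most \<open>d\<close>.\<close>
    hence "?f i \<le> ?f z" using max z(1) D(4) i(2) by blast
    thus False using i(1) z z' by (auto simp: tie_coloring_def)
  qed
  ultimately have "A = D" by (rule subset_antisym)
  thus ?thesis using D(1) by simp
qed

text \<open>The hypothesis at \<open>k = 0\<close> makes \<open>A\<close> nonempty; at
  \<open>k = Max A\<close> it yields a gap below the maximum.\<close>

lemma obtain_gap:
  fixes A :: "nat set"
  assumes A: "A \<subseteq> {1..d}" and ne: "\<And>k. k \<le> d \<Longrightarrow> A \<noteq> {1..k}"
  obtains i j where "j \<in> A" "\<And>x. x \<in> A \<Longrightarrow> x \<le> j" "i < j" "i \<notin> A" "1 \<le> i"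
    "\<And>x. 1 \<le> x \<Longrightarrow> x < i \<Longrightarrow> x \<in> A"
proof -
  have fin: "finite A" using A finite_subset by auto
  have "A \<noteq> {}" using ne[of 0] by simp
  define j where "j = Max A"
  have j: "j \<in> A" "\<And>x. x \<in> A \<Longrightarrow> x \<le> j" using fin \<open>A \<noteq> {}\<close> by (auto simp: j_def)
  have "A \<noteq> {1..j}" using j(1) A by (intro ne) auto
  moreover have "A \<subseteq> {1..j}" using j(2) A by auto
  ultimately obtain x where x: "1 \<le> x \<and> x \<notin> A" "x \<le> j" by fastforce
  define i where "i = (LEAST x. 1 \<le> x \<and> x \<notin> A)"
  have i: "1 \<le> i \<and> i \<notin> A" unfolding i_def by (rule LeastI[of "\<lambda>x. 1 \<le> x \<and> x \<notin> A", OF x(1)])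
  have "i \<le> x" unfolding i_def by (rule Least_le[of "\<lambda>x. 1 \<le> x \<and> x \<notin> A", OF x(1)])
  hence "i < j" using x(2) i j(1) by (metis le_neq_implies_less le_trans)
  moreover have "y \<in> A" if "1 \<le> y" "y < i" for y
    using not_less_Least[of y "\<lambda>x. 1 \<le> x \<and> x \<notin> A"] that by (auto simp: i_def)
  ultimately show thesis using that j i by blast
qed

section \<open>Linear independence and rank\<close>

lemma inj_on_independent_family:
  fixes v :: "'i \<Rightarrow> 'a::real_vector"
  assumes fin: "finite I"
    and zero: "\<And>c. (\<Sum>a\<in>I. c a *\<^sub>R v a) = 0 \<Longrightarrow> \<forall>a\<in>I. c a = 0"
  shows "inj_on v I" "independent (v ` I)"
proof -
  show inj: "inj_on v I"
  proof (rule inj_onI, rule ccontr)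
    fix a b assume ab: "a \<in> I" "b \<in> I" "v a = v b" "a \<noteq> b"
    \<comment> \<open>Two equal members would give the nontrivial relation
      \<open>v a - v b = 0\<close>.\<close>
    let ?c = "\<lambda>x. of_bool (x = a) - of_bool (x = b) :: real"
    have "(\<Sum>x\<in>I. ?c x *\<^sub>R v x) = v a - v b"
      using fin ab by (simp add: scaleR_diff_left sum_subtractf of_bool_def
          if_distrib[of "\<lambda>r. r *\<^sub>R _"] cong: if_cong)
    hence "\<forall>x\<in>I. ?c x = 0" using ab(3) by (intro zero) simp
    hence "?c a = 0" using ab(1) by (rule bspec)
    thus False using ab(4) by simp
  qed
  show "independent (v ` I)"
  proof (rule real_vector.independent_if_scalars_zero)
    show "finite (v ` I)" using fin by simp
    fix u x assume "(\<Sum>x\<in>v ` I. u x *\<^sub>R x) = 0" "x \<in> v ` I"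
    thus "u x = 0" using zero[of "u \<circ> v"] by (auto simp: sum.reindex[OF inj])
  qed
qed

text \<open>The space of word series is infinite-dimensional. The finite \<open>T\<close> guarantees
  a finite basis of \<open>V\<close>; an infinite one would have \<open>card\<close> equal to
  0.\<close>

lemma card_le_dim_if_finite_span:
  fixes S :: "'a::real_vector set"
  assumes "independent S" "S \<subseteq> V" "finite T" "V \<subseteq> span T"
  shows "card S \<le> dim V"
proof -
  obtain B where B: "S \<subseteq> B" "B \<subseteq> V" "independent B" "V \<subseteq> span B"
    using real_vector.maximal_independent_subset_extend[OF assms(2,1)] by metis
  have "finite B"
    using real_vector.independent_span_bound[OF assms(3) B(3)] B(2) assms(4) by blast
  moreover have "dim V = card B"
    using B real_vector.dim_unique by blast
  ultimately show ?thesis using B(1) by (simp add: card_mono)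
qed

lemma finite_schubert_index: "finite (schubert_index d)"
  by (rule finite_subset[of _ "Pow {1..d}"]) (auto simp: schubert_index_def)

lemma card_schubert_index: "card (schubert_index d) = 2 ^ d - d"
proof -
  let ?J = "(\<lambda>k. {1..k}) ` {..<d} :: nat set set"
  have "inj_on (\<lambda>k. {1..k}) {..<d}"
    by (rule inj_onI) (metis card_atLeastAtMost diff_Suc_1)
  hence "card ?J = d" by (simp add: card_image)
  moreover have "schubert_index d = Pow {1..d} - ?J" unfolding schubert_index_def by auto
  moreover have "?J \<subseteq> Pow {1..d}" by auto
  ultimately show ?thesis by (simp add: card_Diff_subset card_Pow)
qed

lemma schubert_index_coefficients_zero:
  assumes sum0: "(\<Sum>A\<in>schubert_index d. c A *\<^sub>R Psi d (schubert d A)) = 0"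
  shows "\<forall>A\<in>schubert_index d. c A = 0"
proof -
  let ?I = "schubert_index d"
  note fin = finite_schubert_index[of d]
  have sub: "A \<subseteq> {1..d}" if "A \<in> ?I" for A using that by (simp add: schubert_index_def)
  have sum_apply: "(\<Sum>A\<in>K. h A) u = (\<Sum>A\<in>K. h A u)"
    for K and h :: "nat set \<Rightarrow> word_series" and u
    by (induction K rule: infinite_finite_induct) auto
  have ev: "(\<Sum>A\<in>?I. c A * of_bool (generic (schubert d A) (\<lambda>i. real (f i)))) = 0"
    if "\<And>i. i \<in> {1..d} \<Longrightarrow> 1 \<le> f i" for f
  proof -
    have "(\<Sum>A\<in>?I. c A * Psi d (schubert d A) (word_of d (restrict f {1..d}))) = 0"
      using fun_cong[OF sum0, of "word_of d (restrict f {1..d})"] by (simp add: sum_apply)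
    thus ?thesis using Psi_restrict[OF matroid_schubert[OF sub] that] by simp
  qed
  have "generic (schubert d A) real" if "A \<in> ?I" for A
    using generic_if_inj_on[OF matroid_schubert[OF sub[OF that]], of real] by (simp add: inj_on_def)
  hence sumc: "(\<Sum>A\<in>?I. c A) = 0" using ev[of "\<lambda>i. i"] by simp
  \<comment> \<open>As the coefficients sum to zero, genericity may be replaced by its negation in
    \<open>ev\<close>.\<close>
  have ng: "(\<Sum>A\<in>?I. c A * of_bool (\<not> generic (schubert d A) (\<lambda>i. real (f i)))) = 0"
    if "\<And>i. i \<in> {1..d} \<Longrightarrow> 1 \<le> f i" for f
    using ev[of f] that sumc
    by (simp add: of_bool_not_iff algebra_simps sum_subtractf)
  \<comment> \<open>The set \<open>{1..d}\<close> is set apart: its Schubert matroid has one basis,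
    so every coloring is generic for it.\<close>
  have zero: "c A = 0" if "A \<in> ?I" "A \<noteq> {1..d}" for A
    using that
  \<comment> \<open>Schubert matroids with more bases come first.\<close>
  proof (induction "card (Pow {1..d}) - card (schubert d A)" arbitrary: A rule: less_induct)
    case less
    note A = sub[OF less.prems(1)]
    have "A \<noteq> {1..k}" if "k \<le> d" for k
      using less.prems that unfolding schubert_index_def by (cases "k = d") auto
    then obtain i j where ij: "j \<in> A" "\<And>x. x \<in> A \<Longrightarrow> x \<le> j" "i < j" "i \<notin> A" "1 \<le> i"
      "\<And>x. 1 \<le> x \<Longrightarrow> x < i \<Longrightarrow> x \<in> A"
      using obtain_gap[OF A] by metis
    let ?f = "tie_coloring d (A - {j}) i j"
    let ?ng = "\<lambda>A'. \<not> generic (schubert d A') (\<lambda>x. real (?f x))"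
    have other: "c A' * of_bool (?ng A') = 0" if A': "A' \<in> ?I - {A}" for A'
    proof (cases "?ng A'")
      case True
      have AA': "A \<in> schubert d A'"
        by (rule not_generic_tie_coloring_imp[OF A sub ij(1,2,3,4,5,6) True]) (use A' in auto)
      have "card A' = card A" using AA' by (simp add: schubert_def)
      \<comment> \<open>The only subset of \<open>{1..d}\<close> with \<open>d\<close> elements is
        \<open>{1..d}\<close>, which \<open>A\<close> is not.\<close>
      hence "A' \<noteq> {1..d}" using less.prems(2) A card_subset_eq[OF _ A] by auto
      moreover have "A' \<notin> schubert d A" using schubert_antisym[OF AA'] A' by auto
      hence "schubert d A \<subset> schubert d A'"
        using schubert_subset[OF AA'] schubert_refl[OF sub[of A']] A' by blast
      moreover have le: "schubert d A' \<subseteq> Pow {1..d}" unfolding schubert_def by auto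
      ultimately have "card (schubert d A) < card (schubert d A')"
        "card (schubert d A') \<le> card (Pow {1..d})"
        by (auto intro!: psubset_card_mono card_mono intro: finite_subset[OF le])
      hence "c A' = 0" using less.hyps[of A'] A' \<open>A' \<noteq> {1..d}\<close> by auto
      thus ?thesis by simp
    qed simp
    have "(\<Sum>A'\<in>?I. c A' * of_bool (?ng A')) = c A * of_bool (?ng A)"
      unfolding sum.remove[OF fin less.prems(1)] by (simp only: sum.neutral[OF ballI[OF other]] add_0_right)
    moreover have "?ng A" using not_generic_tie_coloring_self[OF A ij(1,4,5,3)] .
    moreover have "(\<Sum>A'\<in>?I. c A' * of_bool (?ng A')) = 0"
      by (rule ng) (simp add: tie_coloring_def)
    ultimately show "c A = 0" by simp
  qed
  have top: "{1..d} \<in> ?I" unfolding schubert_index_def by (auto dest: arg_cong[of _ _ card])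
  \<comment> \<open>All other terms of \<open>sumc\<close> have been shown to vanish.\<close>
  have "c {1..d} = 0"
    using sumc zero fin top by (subst (asm) sum.remove[of _ "{1..d}"]) simp_all
  thus ?thesis using zero by blast
qed

theorem theorem4p9:
  fixes d :: nat
  shows "inj_on (\<lambda>A. Psi d (schubert d A)) (schubert_index d) \<and>
         independent ((\<lambda>A. Psi d (schubert d A)) ` schubert_index d) \<and>
         dim (Psi_lin d ` Mat d) \<ge> 2 ^ d - d"
proof -
  let ?v = "\<lambda>A. Psi d (schubert d A)"
  let ?I = "schubert_index d"
  have inj: "inj_on ?v ?I" and ind: "independent (?v ` ?I)"
    using inj_on_independent_family[of ?I ?v, OF finite_schubert_index]
      schubert_index_coefficients_zero by blast+
  have mem: "?v ` ?I \<subseteq> Psi_lin d ` Mat d"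
  proof (rule image_subsetI)
    fix A assume "A \<in> ?I"
    hence "Poly_Mapping.single (schubert d A) 1 \<in> Mat d"
      unfolding Mat_def schubert_index_def using matroid_schubert by simp
    thus "?v A \<in> Psi_lin d ` Mat d" using Psi_lin_single by (metis image_eqI)
  qed
  \<comment> \<open>Finitely many matroids on \<open>{1..d}\<close> give the finite spanning set
    that the dimension bound requires.\<close>
  have "Collect (matroid_on {1..d}) \<subseteq> Pow (Pow {1..d})" unfolding matroid_on_def by blast
  hence "finite (Collect (matroid_on {1..d}))" by (rule finite_subset) simp
  hence fin: "finite (Psi d ` Collect (matroid_on {1..d}))" by simp
  have sp: "Psi_lin d ` Mat d \<subseteq> span (Psi d ` Collect (matroid_on {1..d}))"
  proof (rule image_subsetI)
    fix x assume "x \<in> Mat d"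
    thus "Psi_lin d x \<in> span (Psi d ` Collect (matroid_on {1..d}))"
      unfolding Psi_lin_def Mat_def by (intro span_sum span_scale span_base) blast
  qed
  have "card (?v ` ?I) \<le> dim (Psi_lin d ` Mat d)"
    by (rule card_le_dim_if_finite_span[OF ind mem fin sp])
  thus ?thesis using inj ind by (simp add: card_image card_schubert_index)
qed

end
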